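(* Let $F:\mathbb{R}^n\to\mathbb{R}^n$ be such that $\mathcal{F}_F\neq\emptyset$. Let $R>0$ and $\rho_F<1$ be such that for all $x\in\mathbb{R}^n$, $$\operatorname{dist}(x,\mathcal{F}_F)\le R\ \text{ implies }\ \operatorname{dist}(F(x),\mathcal{F}_F)\le\rho_F\operatorname{dist}(x,\mathcal{F}_F).$$ Then, with $K_F=\tfrac{1}{1-\rho_F}>0$, for all $x\in\mathbb{R}^n$, $$\operatorname{dist}(x,\mathcal{F}_F)\le R\ \text{ implies }\ \operatorname{dist}(x,\mathcal{F}_F)\le K_F\,\|F(x)-x\|.$$
   Context: $\|\cdot\|$ is the Euclidean norm, $\operatorname{dist}(x,S)=\inf_{y\in S}\|x-y\|$, and $\mathcal{F}_F:=\{x\in\mathbb{R}^n: F(x)=x\}$ is the set of fixed points of $F$. *)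

theory Defs
  imports "HOL-Analysis.Analysis"
begin

definition fixed_points :: "('a \<Rightarrow> 'a) \<Rightarrow> 'a set" where
  "fixed_points F = {x. F x = x}"

end

theory Submission
  imports Defs
begin

text \<open>
  The distance to a set is 1-Lipschitz, so one application of \<open>F\<close> can lower the distance to
  the fixed points by at most the step length \<open>\<parallel>F x - x\<parallel>\<close>.  The contraction hypothesis lowers it
  by at least the fraction \<open>1 - \<rho>\<close> of itself; comparing the two gives the error bound.
\<close>

theorem proposition3:
  fixes F :: "real ^ 'n \<Rightarrow> real ^ 'n" and R \<rho> K :: real
  assumes "fixed_points F \<noteq> {}"
    and "R > 0" and "\<rho> < 1"
    and "\<forall>x. infdist x (fixed_points F) \<le> R \<longrightarrow>
           infdist (F x) (fixed_points F) \<le> \<rho> * infdist x (fixed_points F)"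
    and "K = 1 / (1 - \<rho>)"
  shows "K > 0 \<and>
    (\<forall>x. infdist x (fixed_points F) \<le> R \<longrightarrow>
       infdist x (fixed_points F) \<le> K * norm (F x - x))"
proof (intro conjI allI impI)
  show "K > 0"
    using assms(3,5) by simp
next
  fix x
  let ?d = "\<lambda>y. infdist y (fixed_points F)"
  assume "?d x \<le> R"
  then have "?d (F x) \<le> \<rho> * ?d x"
    using assms(4) by blast
  moreover have "?d x \<le> ?d (F x) + norm (F x - x)"
    using infdist_triangle[of x "fixed_points F" "F x"] by (simp add: dist_norm norm_minus_commute)
  ultimately have "(1 - \<rho>) * ?d x \<le> norm (F x - x)"
    by (simp add: algebra_simps)
  then have "?d x \<le> norm (F x - x) / (1 - \<rho>)"
    using assms(3) by (simp add: pos_le_divide_eq mult.commute)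
  then show "?d x \<le> K * norm (F x - x)"
    using assms(5) by simp
qed

end
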